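(* Let $X$ be a complete metric space. Assume that $\mathcal{R}=\{\mathcal{R}_\tau\}_{\tau\in\mathbb{R}}$, $\mathcal{R}_\tau\subset C([\tau,\infty),X)$, is a family of trajectories satisfying the existence and translation properties and such that the associated multivalued process $U$ has the pullback attractor $\mathcal{A}=\{\mathcal{A}(t)\}_{t\in\mathbb{R}}$ and is forward asymptotically compact. Also, let $\mathcal{R}$ be asymptotically autonomous with limit family $\mathcal{R}_0\subset C([0,\infty),X)$, and let the multivalued semiflow $G$ corresponding to $\mathcal{R}_0$ have the global attractor $\mathcal{A}_\infty$. Assume that $$dist_H(\mathcal{A}(t),\mathcal{A}_\infty)\to0\quad\text{as }t\to+\infty.$$ Then $\mathcal{A}$ is a forward attractor.
   Context: Let $\rho$ be the metric of $X$, and $P(X)$ the set of non-empty subsets of $X$. For $A,B\subset X$, $dist(A,B)=\sup_{y\in A}\inf_{x\in B}\rho(y,x)$ and $dist_H(A,B)=\max\{dist(A,B),dist(B,A)\}$. Nonautonomous family $\mathcal{R}=\{\mathcal{R}_\tau\}_{\tau\in\mathbb{R}}$. Existence property: for any $\tau\in\mathbb{R}$, $x\in X$ there is $\varphi\in\mathcal{R}_\tau$ with $\varphi(\tau)=x$. Translation property: for any $s>0$ and $\varphi\in\mathcal{R}_\tau$, $\varphi|_{[\tau+s,\infty)}\in\mathcal{R}_{\tau+s}$. The associated multivalued process is $U(t,\tau,x)=\{\varphi(t):\varphi\in\mathcal{R}_\tau,\ \varphi(\tau)=x\}$, $t\ge\tau$, with $U(t,\tau,B)=\bigcup_{x\in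 B}U(t,\tau,x)$. Autonomous family $\mathcal{R}_0\subset C([0,\infty),X)$ (a separate object, not the member of $\mathcal{R}$ with $\tau=0$). Existence property: for any $x\in X$ there is $\varphi\in\mathcal{R}_0$ with $\varphi(0)=x$. Translation property: for any $s>0$, $\varphi\in\mathcal{R}_0$, $\varphi(\cdot+s)\in\mathcal{R}_0$. The corresponding multivalued semiflow is $G(t,x)=\{\varphi(t):\varphi\in\mathcal{R}_0,\ \varphi(0)=x\}$, $G(t,B)=\bigcup_{x\in B}G(t,x)$. A global attractor of $G$ is a compact set $\mathcal{A}_\infty$ with $\mathcal{A}_\infty\subset G(t,\mathcal{A}_\infty)$ for all $t\ge0$ and $dist(G(t,B),\mathcal{A}_\infty)\to0$ as $t\to+\infty$ for every bounded $B$. $\mathcal{R}$ is asymptotically autonomous with limit family $\mathcal{R}_0$ if $\mathcal{R}_0$ satisfies the (autonomous) existence and translation properties and for any sequences $\tau_n\to+\infty$, $\varphi_n\in\mathcal{R}_{\tau_n}$ such that $\varphi_n(\tau_n)$ converges in $X$, there exist a subsequence $\{\psi_{n_k}\}$ of $\psi_n(\cdot)=\varphi_n(\tau_n+\cdot)$ and $\psi_0\in\mathcal{R}_0$ with $\psi_{n_k}(t)\to\psi_0(t)$ for all $t\ge0$. A family $\{K(t)\}_{t\in\mathbb{R}}$ is negatively invariant if $K(t)\subset U(t,s,K(s))$ for all $t\ge s$. A family of non-empty sets $\mathcal{A}$ is pullback attracting if for every bounded $B$ and fixed $t$, $dist(U(t,t_0,B),\mathcal{A}(t))\to0$ as $t_0\to-\infty$;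 forward attracting if for every bounded $B$ and fixed $t_0$, $dist(U(t,t_0,B),\mathcal{A}(t))\to0$ as $t\to+\infty$. A pullback attractor is a family of non-empty compact negatively invariant sets that is the minimal pullback attracting family of closed sets (i.e. pullback attracting and contained, for each $t$, in any pullback attracting family of closed sets). A forward attractor is a family of non-empty compact negatively invariant sets that is forward attracting. $U$ is forward asymptotically compact if for every $t_0\in\mathbb{R}$, every bounded $B\subset X$ and all $t_n\to+\infty$, every sequence $y_n\in U(t_n,t_0,B)$ has a converging subsequence. *)

theory Defs
  imports "HOL-Analysis.Analysis"
begin

text \<open>
  A function with domain \<open>J\<close> is represented by the total function that is \<open>undefined\<close>
  outside \<open>J\<close> (as in \<^theory>\<open>HOL-Library.FuncSet\<close>), so that equality is equality on \<open>J\<close>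
  and \<^const>\<open>restrict\<close> is restriction of the domain.
\<close>

definition cont_fun :: "real set \<Rightarrow> (real \<Rightarrow> 'a::metric_space) set" where
  "cont_fun J = {\<phi> \<in> extensional J. continuous_on J \<phi>}"

text \<open>
  The semidistance may be infinite, since the first argument need not be bounded; hence the
  values in \<^typ>\<open>ennreal\<close>. There the supremum over the empty set is \<open>0\<close> and the infimum over
  the empty set is \<open>\<infinity>\<close>.
\<close>

definition semidist :: "'a::metric_space set \<Rightarrow> 'a set \<Rightarrow> ennreal" where
  "semidist A B = (SUP y\<in>A. INF x\<in>B. ennreal (dist y x))"

definition hausdorff_dist :: "'a::metric_space set \<Rightarrow> 'a set \<Rightarrow> ennreal" where
  "hausdorff_dist A B = max (semidist A B) (semidist B A)"

definition existence_property :: "(real \<Rightarrow> (real \<Rightarrow> 'a) set) \<Rightarrow> bool" where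
  "existence_property R \<longleftrightarrow> (\<forall>\<tau> x. \<exists>\<phi>\<in>R \<tau>. \<phi> \<tau> = x)"

definition translation_property :: "(real \<Rightarrow> (real \<Rightarrow> 'a) set) \<Rightarrow> bool" where
  "translation_property R \<longleftrightarrow>
     (\<forall>\<tau>. \<forall>s>0. \<forall>\<phi>\<in>R \<tau>. restrict \<phi> {\<tau> + s..} \<in> R (\<tau> + s))"

text \<open>The values of processes and semiflows are relevant only for \<open>t \<ge> \<tau>\<close> and \<open>t \<ge> 0\<close>.\<close>

definition process_of ::
  "(real \<Rightarrow> (real \<Rightarrow> 'a) set) \<Rightarrow> real \<Rightarrow> real \<Rightarrow> 'a \<Rightarrow> 'a set" where
  "process_of R t \<tau> x = {\<phi> t |\<phi>. \<phi> \<in> R \<tau> \<and> \<phi> \<tau> = x}"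

definition process_image ::
  "(real \<Rightarrow> real \<Rightarrow> 'a \<Rightarrow> 'a set) \<Rightarrow> real \<Rightarrow> real \<Rightarrow> 'a set \<Rightarrow> 'a set" where
  "process_image U t \<tau> B = (\<Union>x\<in>B. U t \<tau> x)"

definition existence_property_aut :: "(real \<Rightarrow> 'a) set \<Rightarrow> bool" where
  "existence_property_aut R0 \<longleftrightarrow> (\<forall>x. \<exists>\<phi>\<in>R0. \<phi> 0 = x)"

definition translation_property_aut :: "(real \<Rightarrow> 'a) set \<Rightarrow> bool" where
  "translation_property_aut R0 \<longleftrightarrow>
     (\<forall>s>0. \<forall>\<phi>\<in>R0. restrict (\<lambda>t. \<phi> (t + s)) {0..} \<in> R0)"

definition semiflow_of :: "(real \<Rightarrow> 'a) set \<Rightarrow> real \<Rightarrow> 'a \<Rightarrow> 'a set" where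
  "semiflow_of R0 t x = {\<phi> t |\<phi>. \<phi> \<in> R0 \<and> \<phi> 0 = x}"

definition semiflow_image :: "(real \<Rightarrow> 'a \<Rightarrow> 'a set) \<Rightarrow> real \<Rightarrow> 'a set \<Rightarrow> 'a set" where
  "semiflow_image G t B = (\<Union>x\<in>B. G t x)"

definition global_attractor ::
  "(real \<Rightarrow> 'a \<Rightarrow> 'a set) \<Rightarrow> 'a::metric_space set \<Rightarrow> bool" where
  "global_attractor G A \<longleftrightarrow>
     compact A \<and>
     (\<forall>t\<ge>0. A \<subseteq> semiflow_image G t A) \<and>
     (\<forall>B. bounded B \<longrightarrow> ((\<lambda>t. semidist (semiflow_image G t B) A) \<longlongrightarrow> 0) at_top)"

definition asymptotically_autonomous ::
  "(real \<Rightarrow> (real \<Rightarrow> 'a::metric_space) set) \<Rightarrow> (real \<Rightarrow> 'a) set \<Rightarrow> bool" where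
  "asymptotically_autonomous R R0 \<longleftrightarrow>
     existence_property_aut R0 \<and> translation_property_aut R0 \<and>
     (\<forall>(\<tau> :: nat \<Rightarrow> real) (\<phi> :: nat \<Rightarrow> real \<Rightarrow> 'a).
        filterlim \<tau> at_top sequentially \<longrightarrow> (\<forall>n. \<phi> n \<in> R (\<tau> n)) \<longrightarrow>
        convergent (\<lambda>n. \<phi> n (\<tau> n)) \<longrightarrow>
        (\<exists>(r :: nat \<Rightarrow> nat) \<psi>0. strict_mono r \<and> \<psi>0 \<in> R0 \<and>
           (\<forall>t\<ge>0. (\<lambda>k. \<phi> (r k) (\<tau> (r k) + t)) \<longlonglongrightarrow> \<psi>0 t)))"

definition negatively_invariant ::
  "(real \<Rightarrow> real \<Rightarrow> 'a \<Rightarrow> 'a set) \<Rightarrow> (real \<Rightarrow> 'a set) \<Rightarrow> bool" where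
  "negatively_invariant U K \<longleftrightarrow> (\<forall>s t. s \<le> t \<longrightarrow> K t \<subseteq> process_image U t s (K s))"

definition pullback_attracting ::
  "(real \<Rightarrow> real \<Rightarrow> 'a \<Rightarrow> 'a set) \<Rightarrow> (real \<Rightarrow> 'a::metric_space set) \<Rightarrow> bool" where
  "pullback_attracting U A \<longleftrightarrow>
     (\<forall>t. A t \<noteq> {}) \<and>
     (\<forall>B t. bounded B \<longrightarrow> ((\<lambda>t0. semidist (process_image U t t0 B) (A t)) \<longlongrightarrow> 0) at_bot)"

definition forward_attracting ::
  "(real \<Rightarrow> real \<Rightarrow> 'a \<Rightarrow> 'a set) \<Rightarrow> (real \<Rightarrow> 'a::metric_space set) \<Rightarrow> bool" where
  "forward_attracting U A \<longleftrightarrow>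
     (\<forall>t. A t \<noteq> {}) \<and>
     (\<forall>B t0. bounded B \<longrightarrow> ((\<lambda>t. semidist (process_image U t t0 B) (A t)) \<longlongrightarrow> 0) at_top)"

definition pullback_attractor ::
  "(real \<Rightarrow> real \<Rightarrow> 'a \<Rightarrow> 'a set) \<Rightarrow> (real \<Rightarrow> 'a::metric_space set) \<Rightarrow> bool" where
  "pullback_attractor U A \<longleftrightarrow>
     (\<forall>t. A t \<noteq> {} \<and> compact (A t)) \<and>
     negatively_invariant U A \<and>
     pullback_attracting U A \<and>
     (\<forall>K. (\<forall>t. closed (K t)) \<longrightarrow> pullback_attracting U K \<longrightarrow> (\<forall>t. A t \<subseteq> K t))"

definition forward_attractor ::
  "(real \<Rightarrow> real \<Rightarrow> 'a \<Rightarrow> 'a set) \<Rightarrow> (real \<Rightarrow> 'a::metric_space set) \<Rightarrow> bool" where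
  "forward_attractor U A \<longleftrightarrow>
     (\<forall>t. A t \<noteq> {} \<and> compact (A t)) \<and>
     negatively_invariant U A \<and>
     forward_attracting U A"

definition forward_asymptotically_compact ::
  "(real \<Rightarrow> real \<Rightarrow> 'a \<Rightarrow> 'a::metric_space set) \<Rightarrow> bool" where
  "forward_asymptotically_compact U \<longleftrightarrow>
     (\<forall>t0 B (t :: nat \<Rightarrow> real) (y :: nat \<Rightarrow> 'a).
        bounded B \<longrightarrow> filterlim t at_top sequentially \<longrightarrow> (\<forall>n. t n \<ge> t0) \<longrightarrow>
        (\<forall>n. y n \<in> process_image U (t n) t0 B) \<longrightarrow>
        (\<exists>r :: nat \<Rightarrow> nat. strict_mono r \<and> convergent (y \<circ> r)))"

end

theory Submission
  imports Defs
begin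

text \<open>
  A limit \<open>y\<close> of states \<open>\<phi>\<^sub>n(t\<^sub>n)\<close> with \<open>t\<^sub>n \<rightarrow> \<infinity>\<close> can be traced back by any time \<open>T\<close>: by forward
  asymptotic compactness \<open>\<phi>\<^sub>n(t\<^sub>n - T)\<close> converges along a subsequence to a point of a bounded set
  \<open>C\<close> independent of \<open>T\<close>, and asymptotic autonomy then gives a trajectory of the limit family
  joining that point to \<open>y\<close> in time \<open>T\<close>. Hence \<open>y \<in> G(T, C)\<close> for all \<open>T\<close>, so \<open>y\<close> is at distance \<open>0\<close>
  from the global attractor, to which the sections \<open>\<A>(t)\<close> converge.
\<close>

text \<open>Adding a constant is monotone and continuous from the right, so it commutes with infima
  of non-empty sets.\<close>

lemma INF_ennreal_const_add_set:
  fixes f :: "'i \<Rightarrow> ennreal"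
  assumes "I \<noteq> {}"
  shows "(INF i\<in>I. c + f i) = c + (INF i\<in>I. f i)"
  using continuous_at_Inf_mono[of "\<lambda>x. c + x" "f ` I"] assms
    continuous_add[of "at_right (Inf (f ` I))" "\<lambda>x. c" "\<lambda>x. x"]
  by (simp add: mono_def image_comp o_def add_left_mono)

lemma INF_dist_le_add_INF_dist:
  fixes y z :: "'a::metric_space"
  shows "(INF x\<in>C. ennreal (dist y x)) \<le> ennreal (dist y z) + (INF x\<in>C. ennreal (dist z x))"
proof (cases "C = {}")
  case False
  have "(INF x\<in>C. ennreal (dist y x)) \<le> (INF x\<in>C. ennreal (dist y z) + ennreal (dist z x))"
    by (intro INF_superset_mono order_refl)
      (metis dist_triangle ennreal_leI ennreal_plus zero_le_dist)
  also have "\<dots> = ennreal (dist y z) + (INF x\<in>C. ennreal (dist z x))"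
    using False by (rule INF_ennreal_const_add_set)
  finally show ?thesis .
qed (simp add: top_add)

lemma INF_dist_le_semidist: "y \<in> D \<Longrightarrow> (INF x\<in>C. ennreal (dist y x)) \<le> semidist D C"
  unfolding semidist_def by (rule SUP_upper)

text \<open>Pass through an arbitrary point \<open>z\<close> of \<open>C\<close>: the distance from
  \<open>z\<close> to \<open>D\<close> is at most \<open>semidist C D\<close>, and the infimum over
  \<open>z\<close> leaves the distance to \<open>C\<close>.\<close>

lemma INF_dist_le_add_semidist:
  fixes y :: "'a::metric_space"
  shows "(INF x\<in>D. ennreal (dist y x)) \<le> (INF x\<in>C. ennreal (dist y x)) + semidist C D"
proof (cases "C = {}")
  case False
  have "(INF x\<in>D. ennreal (dist y x)) \<le> (INF x\<in>C. ennreal (dist y x) + semidist C D)"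
  proof (rule INF_greatest)
    fix z assume "z \<in> C"
    then show "(INF x\<in>D. ennreal (dist y x)) \<le> ennreal (dist y z) + semidist C D"
      by (rule order_trans[OF INF_dist_le_add_INF_dist add_left_mono[OF INF_dist_le_semidist]])
  qed
  also have "\<dots> = (INF x\<in>C. ennreal (dist y x)) + semidist C D"
    using INF_ennreal_const_add_set[OF False] by (simp add: add.commute)
  finally show ?thesis .
qed (simp add: top_add)

lemma translation_property_restrict:
  assumes "translation_property R" "\<phi> \<in> R \<tau>" "\<tau> < \<sigma>"
  shows "restrict \<phi> {\<sigma>..} \<in> R \<sigma>"
  using assms(1)[unfolded translation_property_def, rule_format, of "\<sigma> - \<tau>" \<phi> \<tau>] assms(2,3)
  by simp

lemma mem_process_image_iff:
  "y \<in> process_image (process_of R) t \<tau> B \<longleftrightarrow> (\<exists>\<phi>\<in>R \<tau>. \<phi> \<tau> \<in> B \<and> y = \<phi> t)"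
  unfolding process_image_def process_of_def by auto

text \<open>Otherwise there are states at times tending to infinity whose distance from a fixed
  \<open>x0\<close> exceeds \<open>n\<close>. No subsequence of them is bounded, so none converges,
  against asymptotic compactness.\<close>

lemma forward_asymptotically_compact_eventually_bounded:
  fixes U :: "real \<Rightarrow> real \<Rightarrow> 'a \<Rightarrow> 'a::metric_space set"
  assumes "forward_asymptotically_compact U" "bounded B"
  obtains T where "bounded (\<Union>t\<in>{T..}. process_image U t t0 B)"
proof (rule ccontr)
  assume "\<not> thesis"
  with that have unb: "\<not> bounded (\<Union>t\<in>{T..}. process_image U t t0 B)" for T
    by blast
  fix x0 :: 'a
  have "\<exists>t y. t \<ge> t0 + real n \<and> y \<in> process_image U t t0 B \<and> dist x0 y > real n" for n
    using unb[of "t0 + real n"] unfolding bounded_any_center[where a = x0]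
    by (auto simp: not_le dest!: spec[of _ "real n"])
  then obtain t y where ty: "\<And>n. t n \<ge> t0 + real n"
    "\<And>n. y n \<in> process_image U (t n) t0 B" "\<And>n. dist x0 (y n) > real n"
    by metis
  have "filterlim t at_top sequentially"
    by (rule filterlim_at_top_mono[OF filterlim_tendsto_add_at_top[OF tendsto_const[of t0] filterlim_real_sequentially]])
      (simp add: ty)
  moreover have "t n \<ge> t0" for n
    using ty(1)[of n] by (meson le_add_same_cancel1 of_nat_0_le_iff order_trans)
  ultimately obtain r :: "nat \<Rightarrow> nat" where r: "strict_mono r" "convergent (y \<circ> r)"
    using assms ty(2) unfolding forward_asymptotically_compact_def by blast
  from r(2) have "bounded (range (y \<circ> r))"
    unfolding convergent_def using convergent_imp_bounded by blast
  then obtain e where e: "\<And>n. dist x0 (y (r n)) \<le> e"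
    unfolding bounded_any_center[where a = x0] by auto
  obtain n where "e < real n"
    using reals_Archimedean2 by blast
  also have "\<dots> \<le> real (r n)"
    using seq_suble[OF r(1)] by simp
  finally show False
    using ty(3)[of "r n"] e[of n] by simp
qed

text \<open>The set \<open>C\<close> does not depend on \<open>T\<close>, which later allows
  \<open>T\<close> to tend to infinity with \<open>C\<close> fixed.\<close>

lemma limit_in_semiflow_image:
  fixes R :: "real \<Rightarrow> (real \<Rightarrow> 'a::metric_space) set"
  assumes R: "translation_property R"
    and fac: "forward_asymptotically_compact (process_of R)"
    and aa: "asymptotically_autonomous R R0"
    and B: "bounded B"
    and t: "filterlim t at_top sequentially"
    and y: "\<And>n. y n \<in> process_image (process_of R) (t n) t0 B"
    and lim: "y \<longlonglongrightarrow> l"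
    and C: "closed C" "\<And>s. s \<ge> S \<Longrightarrow> process_image (process_of R) s t0 B \<subseteq> C"
    and T: "T \<ge> 0"
  shows "l \<in> semiflow_image (semiflow_of R0) T C"
proof -
  obtain \<phi> where \<phi>: "\<And>n. \<phi> n \<in> R t0" "\<And>n. \<phi> n t0 \<in> B" "\<And>n. y n = \<phi> n (t n)"
    using y unfolding mem_process_image_iff by metis
  \<comment> \<open>Dropping the first \<open>N\<close> terms puts every time \<open>t n - T\<close>
    past \<open>S\<close>, so that the state there lies in \<open>C\<close>, and strictly past
    \<open>t0\<close>, because the translation property requires a positive shift.\<close>
  have "eventually (\<lambda>n. t n \<ge> max S (t0 + 1) + T) sequentially"
    using t by (simp add: filterlim_at_top)
  then obtain N where N: "\<And>n. n \<ge> N \<Longrightarrow> t n \<ge> max S (t0 + 1) + T"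
    unfolding eventually_sequentially by blast
  define \<tau> where "\<tau> n = t (n + N) - T" for n
  define z where "z n = \<phi> (n + N) (\<tau> n)" for n
  have \<tau>: "\<tau> n \<ge> S" "\<tau> n > t0" for n
    using N[of "n + N"] by (auto simp: \<tau>_def)
  have \<tau>_top: "filterlim \<tau> at_top sequentially"
    using filterlim_tendsto_add_at_top[OF tendsto_const[of "- T"] filterlim_compose[OF t filterlim_add_const_nat_at_top[of N]]]
    by (simp add: \<tau>_def[abs_def])
  have z: "z n \<in> process_image (process_of R) (\<tau> n) t0 B" for n
    using \<phi>(1,2) by (auto simp: mem_process_image_iff z_def)
  obtain r :: "nat \<Rightarrow> nat" where r: "strict_mono r" "convergent (z \<circ> r)"
    using fac B \<tau>_top \<tau>(2)[THEN less_imp_le] z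
    unfolding forward_asymptotically_compact_def by blast
  \<comment> \<open>The trajectories start at \<open>t0\<close>; cut off at the times
    \<open>\<tau> (r n)\<close>, they belong to the families to which asymptotic autonomy applies,
    and their initial values \<open>z (r n)\<close> converge.\<close>
  define \<xi> where "\<xi> n = restrict (\<phi> (r n + N)) {\<tau> (r n)..}" for n
  have "\<xi> n \<in> R (\<tau> (r n))" for n
    unfolding \<xi>_def by (rule translation_property_restrict[OF R \<phi>(1) \<tau>(2)])
  moreover have "filterlim (\<lambda>n. \<tau> (r n)) at_top sequentially"
    by (rule filterlim_compose[OF \<tau>_top filterlim_subseq[OF r(1)]])
  moreover have "convergent (\<lambda>n. \<xi> n (\<tau> (r n)))"
    using r(2) by (simp add: \<xi>_def z_def o_def)
  ultimately have "\<exists>(q :: nat \<Rightarrow> nat) \<psi>. strict_mono q \<and> \<psi> \<in> R0 \<and>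
      (\<forall>s\<ge>0. (\<lambda>k. \<xi> (q k) (\<tau> (r (q k)) + s)) \<longlonglongrightarrow> \<psi> s)"
    using aa[unfolded asymptotically_autonomous_def, THEN conjunct2, THEN conjunct2,
        rule_format, of "\<lambda>n. \<tau> (r n)" \<xi>] by blast
  then obtain q :: "nat \<Rightarrow> nat" and \<psi> where q: "strict_mono q" and \<psi>: "\<psi> \<in> R0"
    and conv: "\<And>s. s \<ge> 0 \<Longrightarrow> (\<lambda>k. \<xi> (q k) (\<tau> (r (q k)) + s)) \<longlonglongrightarrow> \<psi> s"
    by blast
  have "(\<lambda>k. z (r (q k))) \<longlonglongrightarrow> \<psi> 0"
    using conv[of 0] by (simp add: \<xi>_def z_def)
  then have "\<psi> 0 \<in> C"
    by (rule closed_sequentially[OF C(1), rotated]) (use z C(2) \<tau>(1) in blast)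
  \<comment> \<open>By the choice of \<open>\<tau>\<close>, time \<open>T\<close> after
    \<open>\<tau> (r (q k))\<close> is \<open>t (r (q k) + N)\<close>, where the trajectory takes a
    value of the original sequence \<open>y\<close>.\<close>
  moreover have "\<psi> T = l"
  proof (rule LIMSEQ_unique)
    show "(\<lambda>k. y (r (q k) + N)) \<longlonglongrightarrow> \<psi> T"
      using conv[OF T] T by (simp add: \<xi>_def \<phi>(3)) (simp add: \<tau>_def)
    show "(\<lambda>k. y (r (q k) + N)) \<longlonglongrightarrow> l"
      using LIMSEQ_subseq_LIMSEQ[OF LIMSEQ_ignore_initial_segment[OF lim, of N] strict_mono_o[OF r(1) q]]
      by (simp add: o_def)
  qed
  ultimately show ?thesis
    using \<psi> unfolding semiflow_image_def semiflow_of_def by blast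
qed

text \<open>The point \<open>l\<close> lies in the image of one bounded set at every time
  \<open>T\<close>, so its distance to \<open>Ainf\<close> is a constant below a quantity that tends
  to \<open>0\<close>.\<close>

lemma limit_INF_dist_global_attractor:
  fixes R :: "real \<Rightarrow> (real \<Rightarrow> 'a::metric_space) set"
  assumes "translation_property R"
    and fac: "forward_asymptotically_compact (process_of R)"
    and "asymptotically_autonomous R R0"
    and ga: "global_attractor (semiflow_of R0) Ainf"
    and B: "bounded B"
    and "filterlim t at_top sequentially"
    and "\<And>n. y n \<in> process_image (process_of R) (t n) t0 B"
    and "y \<longlonglongrightarrow> l"
  shows "(INF x\<in>Ainf. ennreal (dist l x)) = 0"
proof -
  obtain S where S: "bounded (\<Union>s\<in>{S..}. process_image (process_of R) s t0 B)"
    using forward_asymptotically_compact_eventually_bounded[OF fac B] .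
  \<comment> \<open>The closure makes \<open>C\<close> closed, as the limit argument requires, and
    keeps it bounded, so that \<open>Ainf\<close> attracts it.\<close>
  define C where "C = closure (\<Union>s\<in>{S..}. process_image (process_of R) s t0 B)"
  have "process_image (process_of R) s t0 B \<subseteq> C" if "s \<ge> S" for s
    unfolding C_def using that by (intro order_trans[OF _ closure_subset]) auto
  then have l: "l \<in> semiflow_image (semiflow_of R0) T C" if "T \<ge> 0" for T
    using limit_in_semiflow_image[OF assms(1,2,3,5-8), of C S T] that by (auto simp: C_def)
  have "eventually (\<lambda>T. (INF x\<in>Ainf. ennreal (dist l x)) \<le>
      semidist (semiflow_image (semiflow_of R0) T C) Ainf) at_top"
    using eventually_ge_at_top[of 0] by eventually_elim (rule INF_dist_le_semidist[OF l])
  moreover have "((\<lambda>T. semidist (semiflow_image (semiflow_of R0) T C) Ainf) \<longlongrightarrow> 0) at_top"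
    using ga S unfolding global_attractor_def C_def by (auto intro: bounded_closure)
  ultimately have "(INF x\<in>Ainf. ennreal (dist l x)) \<le> 0"
    by (intro tendsto_lowerbound) auto
  then show ?thesis by simp
qed

theorem theorem27:
  fixes R :: "real \<Rightarrow> (real \<Rightarrow> 'a::complete_space) set"
    and R0 :: "(real \<Rightarrow> 'a) set"
    and A :: "real \<Rightarrow> 'a set"
    and Ainf :: "'a set"
  assumes "\<And>\<tau>. R \<tau> \<subseteq> cont_fun {\<tau>..}"
    and "existence_property R"
    and "translation_property R"
    and "pullback_attractor (process_of R) A"
    and "forward_asymptotically_compact (process_of R)"
    and "R0 \<subseteq> cont_fun {0..}"
    and "asymptotically_autonomous R R0"
    and "global_attractor (semiflow_of R0) Ainf"
    and "((\<lambda>t. hausdorff_dist (A t) Ainf) \<longlongrightarrow> 0) at_top"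
  shows "forward_attractor (process_of R) A"
proof -
  let ?d = "\<lambda>y C. INF x\<in>C. ennreal (dist y x)"
  have "((\<lambda>t. semidist (process_image (process_of R) t t0 B) (A t)) \<longlongrightarrow> 0) at_top"
    (is "(?f \<longlongrightarrow> 0) at_top") if B: "bounded B" for B t0
  proof (rule ccontr)
    assume "\<not> (?f \<longlongrightarrow> 0) at_top"
    then obtain e where e: "e > 0" "\<not> eventually (\<lambda>t. ?f t < e) at_top"
      unfolding order_tendsto_iff by auto
    \<comment> \<open>A supremum that is at least \<open>e\<close> need not be attained, but some
      state exceeds any smaller bound \<open>e'\<close>.\<close>
    obtain e' where e': "0 < e'" "e' < e"
      using dense[OF e(1)] by blast
    have "\<exists>t y. t \<ge> t0 + real n \<and> y \<in> process_image (process_of R) t t0 B \<and> ?d y (A t) > e'" for n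
    proof -
      obtain t where t: "t \<ge> t0 + real n" "?f t \<ge> e"
        using e(2) unfolding eventually_at_top_linorder by (meson not_le)
      then have "?f t > e'"
        using e'(2) by simp
      then show ?thesis
        unfolding semidist_def less_SUP_iff using t(1) by blast
    qed
    then obtain t y where ty: "\<And>n. t n \<ge> t0 + real n"
      "\<And>n. y n \<in> process_image (process_of R) (t n) t0 B" "\<And>n. ?d (y n) (A (t n)) > e'"
      by metis
    have t_top: "filterlim t at_top sequentially"
      by (rule filterlim_at_top_mono[OF filterlim_tendsto_add_at_top[OF tendsto_const[of t0] filterlim_real_sequentially]])
        (simp add: ty)
    have "t n \<ge> t0" for n
      using ty(1)[of n] by (meson le_add_same_cancel1 of_nat_0_le_iff order_trans)
    then obtain r :: "nat \<Rightarrow> nat" where r: "strict_mono r" "convergent (y \<circ> r)"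
      using assms(5) B t_top ty(2) unfolding forward_asymptotically_compact_def by blast
    then obtain l where l: "(\<lambda>n. y (r n)) \<longlonglongrightarrow> l"
      by (auto simp: convergent_def o_def)
    have tr: "filterlim (\<lambda>n. t (r n)) at_top sequentially"
      by (rule filterlim_compose[OF t_top filterlim_subseq[OF r(1)]])
    have l0: "?d l Ainf = 0"
      by (rule limit_INF_dist_global_attractor[OF assms(3,5,7,8) B tr ty(2) l])
    \<comment> \<open>Go from \<open>y (r n)\<close> via \<open>l\<close> to \<open>Ainf\<close> and
      on to \<open>A (t (r n))\<close>: the leg from \<open>l\<close> to \<open>Ainf\<close> costs
      nothing, and the other two tend to \<open>0\<close>.\<close>
    have "?d (y (r n)) (A (t (r n))) \<le>
        ennreal (dist (y (r n)) l) + hausdorff_dist (A (t (r n))) Ainf" for n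
    proof -
      have "?d (y (r n)) (A (t (r n))) \<le> ?d (y (r n)) Ainf + semidist Ainf (A (t (r n)))"
        by (rule INF_dist_le_add_semidist)
      also have "\<dots> \<le> ennreal (dist (y (r n)) l) + hausdorff_dist (A (t (r n))) Ainf"
        using INF_dist_le_add_INF_dist[where y = "y (r n)" and z = l and C = Ainf]
        by (intro add_mono) (auto simp: l0 hausdorff_dist_def)
      finally show ?thesis .
    qed
    then have le: "e' \<le> ennreal (dist (y (r n)) l) + hausdorff_dist (A (t (r n))) Ainf" for n
      using ty(3)[of "r n"] by (meson less_imp_le order_trans)
    have "(\<lambda>n. dist (y (r n)) l) \<longlonglongrightarrow> 0"
      by (rule iffD1[OF tendsto_dist_iff l])
    from tendsto_add[OF tendsto_ennrealI[OF this] filterlim_compose[OF assms(9) tr]]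
    have "e' \<le> ennreal 0 + 0"
      by (rule LIMSEQ_le_const) (use le in blast)
    with e'(1) show False by simp
  qed
  \<comment> \<open>Non-emptiness, compactness and negative invariance carry over from the pullback
    attractor.\<close>
  then show ?thesis
    using assms(4) by (simp add: forward_attractor_def pullback_attractor_def forward_attracting_def)
qed

end
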